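(* For each $i \in \mathbb{N}$ let $X_i$ be a Polish space, and let $X = \prod_{i \in \mathbb{N}} X_i$ with the product topology. For each product Borel probability measure $\sigma = \bigotimes_{i\in\mathbb{N}} \sigma_i$ on $X$ (with $\sigma_i$ a Borel probability measure on $X_i$ for each $i$), each bounded Borel-measurable function $f : X \to \mathbb{R}$, and each $\epsilon > 0$, the set $S_\epsilon(\sigma,f)$ of strong $\epsilon$-approximations of the expectation of $f$ under $\sigma$ has $\sigma$-measure $1$.
   Context: $\mathbb{N} = \{1,2,\ldots\}$. A point $x_i \in X_i$ is also used to denote the Dirac measure on $X_i$ concentrated at $x_i$. $\mathbb{E}_\tau[f]$ denotes the expectation of $f$ under the probability measure $\tau$. Definition. For $\epsilon \ge 0$, a point $x = (x_i)_{i\in\mathbb{N}} \in X$ is a strong $\epsilon$-approximation of the expectation of $f$ under $\sigma$ if there exists $n \in \mathbb{N}$ such that $$\big|\mathbb{E}_{\sigma_1 \otimes \cdots \otimes \sigma_{n-1} \otimes x_n \otimes x_{n+1} \otimes \cdots}[f] - \mathbb{E}_\sigma[f]\big| \le \epsilon.$$ $S_\epsilon(\sigma,f) \subseteq X$ denotes the set of strong $\epsilon$-approximations of the expectation of $f$ under $\sigma$. *)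

theory Defs
  imports "HOL-Probability.Probability"
begin

text \<open>
  The spaces \<open>X i\<close> are abstract topologies, possibly with different carriers, on one type
  \<open>'a\<close>.  This is no restriction: a countable family of spaces can be realised on the
  (tagged) disjoint union of its members.  The index set is \<open>{1..}\<close>; families are never
  evaluated at index 0, and points of the product are the extensional functions on \<open>{1..}\<close>.
\<close>

definition polish_topology :: "'a topology \<Rightarrow> bool" where
  "polish_topology T \<longleftrightarrow> completely_metrizable_space T \<and> separable_space T"

definition borel_top :: "'a topology \<Rightarrow> 'a measure" where
  "borel_top T = sigma (topspace T) {U. openin T U}"

definition borel_prob :: "'a topology \<Rightarrow> 'a measure \<Rightarrow> bool" where
  "borel_prob T \<mu> \<longleftrightarrow> prob_space \<mu> \<and> sets \<mu> = sets (borel_top T)"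

abbreviation prod_top :: "(nat \<Rightarrow> 'a topology) \<Rightarrow> (nat \<Rightarrow> 'a) topology" where
  "prod_top X \<equiv> product_topology X {1..}"

text \<open>
  The product measure lives on the product of the Borel \<open>\<sigma>\<close>-algebras, which for countably many
  Polish (hence second countable) factors is the Borel \<open>\<sigma>\<close>-algebra of the product topology.
\<close>

abbreviation prod_meas :: "(nat \<Rightarrow> 'a measure) \<Rightarrow> (nat \<Rightarrow> 'a) measure" where
  "prod_meas \<mu> \<equiv> \<Pi>\<^sub>M i\<in>{1..}. \<mu> i"

definition tail_dirac :: "(nat \<Rightarrow> 'a measure) \<Rightarrow> nat \<Rightarrow> (nat \<Rightarrow> 'a) \<Rightarrow> nat \<Rightarrow> 'a measure" where
  "tail_dirac \<sigma> n x = (\<lambda>i. if i < n then \<sigma> i else return (\<sigma> i) (x i))"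

definition strong_approx ::
    "(nat \<Rightarrow> 'a topology) \<Rightarrow> real \<Rightarrow> (nat \<Rightarrow> 'a measure) \<Rightarrow> ((nat \<Rightarrow> 'a) \<Rightarrow> real) \<Rightarrow> (nat \<Rightarrow> 'a) set"
  where
  "strong_approx X \<epsilon> \<sigma> f =
     {x \<in> topspace (prod_top X).
        \<exists>n\<ge>1. \<bar>(\<integral>y. f y \<partial>prod_meas (tail_dirac \<sigma> n x)) - (\<integral>y. f y \<partial>prod_meas \<sigma>)\<bar> \<le> \<epsilon>}"

end

theory Submission
  imports Defs
begin

text \<open>
  Write \<open>P\<close> for the product measure and \<open>g n x\<close> for the expectation of \<open>f\<close> when the coordinates
  below \<open>n\<close> are random and the others are fixed to those of \<open>x\<close>.  As a function of \<open>x\<close>, this is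
  the conditional expectation of \<open>f\<close> given the coordinates from \<open>n\<close> on.  By reverse martingale
  convergence and Kolmogorov's 0-1 law, \<open>g n\<close> tends almost surely to the mean of \<open>f\<close>, so almost
  every \<open>x\<close> is a strong approximation.  The proof below uses less: a strong approximation needs
  only one good \<open>n\<close>, so the set of points that fail has, for every \<open>n\<close>, at most the measure of
  the points where \<open>g n\<close> is farther than \<open>\<epsilon>\<close> from the mean of \<open>f\<close>.  By Markov's inequality it is
  enough that \<open>g n\<close> tends to the mean of \<open>f\<close> in \<open>L\<^sup>1\<close>, which needs no martingale theory.

  Convergence in \<open>L\<^sup>1\<close> (lemma \<open>average_out_L1_convergence\<close>) has two ingredients.  Functions of
  finitely many coordinates are dense in \<open>L\<^sup>1\<close> (\<open>cylinder_approximable_integrable\<close>), and for such a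
  function averaging out all the relevant coordinates gives exactly its mean.  Averaging is an
  \<open>L\<^sup>1\<close>-contraction (\<open>integral_abs_average_out_le\<close>), because replacing some coordinates of a
  \<open>P\<close>-random point by those of an independent \<open>P\<close>-random point gives a \<open>P\<close>-random point again
  (\<open>distr_graft\<close>).

  Topology enters only through measurability: the factors are second countable, so the Borel
  \<open>\<sigma>\<close>-algebra of the product space, for which \<open>f\<close> is measurable, is contained in the product
  \<open>\<sigma>\<close>-algebra, on which \<open>P\<close> is defined.
\<close>

section \<open>Borel sets of a countable product\<close>

text \<open>
  The balls of radius \<open>1/(n+1)\<close> around the points of a countable dense set form a countable base.
\<close>

lemma separable_metrizable_imp_second_countable:
  assumes "metrizable_space X" "separable_space X"
  shows "second_countable X"
proof -
  obtain M d where "Metric_space M d" and X: "X = Metric_space.mtopology M d"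
    using assms(1) by (auto simp: metrizable_space_def)
  then interpret Metric_space M d by simp
  obtain C where C: "countable C" "C \<subseteq> M" "X closure_of C = M"
    using assms(2) by (auto simp: separable_space_def X)
  define \<B> where "\<B> = (\<lambda>(c, n). mball c (inverse (real (Suc n)))) ` (C \<times> (UNIV :: nat set))"
  have "\<exists>V\<in>\<B>. x \<in> V \<and> V \<subseteq> U" if U: "openin X U" and x: "x \<in> U" for U x
  proof -
    obtain r where r: "r > 0" "mball x r \<subseteq> U"
      using U x unfolding X openin_mtopology by blast
    have xM: "x \<in> M"
      using openin_subset[OF U] x by (auto simp: X)
    obtain n where n: "inverse (real (Suc n)) < r / 2"
      using reals_Archimedean[of "r / 2"] r by auto
    have "x \<in> mtopology closure_of C"
      using C(3) xM by (simp add: X)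
    moreover have "inverse (real (Suc n)) > 0" by simp
    ultimately obtain c where c: "c \<in> C" "d x c < inverse (real (Suc n))"
      unfolding metric_closure_of mem_Collect_eq in_mball by blast
    have "mball c (inverse (real (Suc n))) \<subseteq> mball x r"
    proof
      fix y assume "y \<in> mball c (inverse (real (Suc n)))"
      then have y: "y \<in> M" "c \<in> M" "d c y < inverse (real (Suc n))"
        by auto
      then have "d x y \<le> d x c + d c y"
        using triangle xM by blast
      with y c n have "d x y < r" by linarith
      then show "y \<in> mball x r" using y xM by simp
    qed
    moreover have "x \<in> mball c (inverse (real (Suc n)))"
      using c C(2) xM by (simp only: in_mball commute[of c x]) blast
    moreover have "mball c (inverse (real (Suc n))) \<in> \<B>"
      using c(1) unfolding \<B>_def by blast
    ultimately show ?thesis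
      using r(2) by blast
  qed
  moreover have "countable \<B>"
    using C(1) by (auto simp: \<B>_def)
  moreover have "\<forall>V\<in>\<B>. openin X V"
    by (auto simp: \<B>_def X)
  ultimately show ?thesis
    unfolding second_countable_def by blast
qed

lemma space_borel_top [simp]: "space (borel_top T) = topspace T"
  unfolding borel_top_def by (rule space_measure_of) (auto dest: openin_subset)

lemma openin_in_sets_borel_top: "openin T U \<Longrightarrow> U \<in> sets (borel_top T)"
  unfolding borel_top_def by (subst sets_measure_of) (auto dest: openin_subset)

lemma mem_prod_emb_PiE:
  "J \<subseteq> I \<Longrightarrow> x \<in> prod_emb I M J (Pi\<^sub>E J A) \<longleftrightarrow> x \<in> space (PiM I M) \<and> (\<forall>i\<in>J. x i \<in> A i)"
  by (auto simp: prod_emb_def space_PiM PiE_iff restrict_def extensional_def)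

lemma open_box_in_sets_PiM_borel:
  assumes "finite J" "J \<subseteq> I" "\<And>i. i \<in> J \<Longrightarrow> openin (X i) (V i)"
  shows "{x \<in> topspace (product_topology X I). \<forall>i\<in>J. x i \<in> V i}
    \<in> sets (PiM I (\<lambda>i. borel_top (X i)))"
proof -
  have "prod_emb I (\<lambda>i. borel_top (X i)) J (Pi\<^sub>E J V) \<in> sets (PiM I (\<lambda>i. borel_top (X i)))"
    using assms by (intro sets_PiM_I) (auto intro: openin_in_sets_borel_top)
  moreover have "prod_emb I (\<lambda>i. borel_top (X i)) J (Pi\<^sub>E J V)
      = {x \<in> topspace (product_topology X I). \<forall>i\<in>J. x i \<in> V i}"
    using assms(2) by (auto simp: mem_prod_emb_PiE space_PiM)
  ultimately show ?thesis by simp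
qed

text \<open>
  Boxes with finitely many sides from countable bases of the factors, and full sides elsewhere,
  form a countable base of the product.  Hence an open set is a countable union of measurable
  boxes; an uncountable union would give no information about measurability.
\<close>

lemma openin_product_in_sets_PiM_borel:
  assumes I: "countable I" and X: "\<And>i. i \<in> I \<Longrightarrow> second_countable (X i)"
    and U: "openin (product_topology X I) U"
  shows "U \<in> sets (PiM I (\<lambda>i. borel_top (X i)))"
proof -
  let ?T = "topspace (product_topology X I)"
  obtain B where B: "\<And>i. i \<in> I \<Longrightarrow> countable (B i)"
      "\<And>i V. i \<in> I \<Longrightarrow> V \<in> B i \<Longrightarrow> openin (X i) V"
      "\<And>i W x. i \<in> I \<Longrightarrow> openin (X i) W \<Longrightarrow> x \<in> W \<Longrightarrow> \<exists>V\<in>B i. x \<in> V \<and> V \<subseteq> W"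
    using X unfolding second_countable_def by metis
  define box where "box J V = {x \<in> ?T. \<forall>i\<in>J. x i \<in> V i}" for J V
  define \<C> where "\<C> = (\<Union>J\<in>{J. finite J \<and> J \<subseteq> I}. box J ` (Pi\<^sub>E J B))"
  have count: "countable \<C>"
    unfolding \<C>_def
    by (intro countable_UN countable_image countable_PiE countable_Collect_finite_subset I)
       (auto intro: B(1))
  have "\<exists>V\<in>\<C>. x \<in> V \<and> V \<subseteq> U" if x: "x \<in> U" for x
  proof -
    obtain W where fin: "finite {i \<in> I. W i \<noteq> topspace (X i)}"
        and W: "\<And>i. i \<in> I \<Longrightarrow> openin (X i) (W i)" "x \<in> Pi\<^sub>E I W" "Pi\<^sub>E I W \<subseteq> U"
      using U x unfolding openin_product_topology_alt by metis
    define J where "J = {i \<in> I. W i \<noteq> topspace (X i)}"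
    have "\<exists>V\<in>B i. x i \<in> V \<and> V \<subseteq> W i" if "i \<in> J" for i
      using that W by (intro B(3)) (auto simp: J_def PiE_iff)
    then obtain V where V: "\<And>i. i \<in> J \<Longrightarrow> V i \<in> B i \<and> x i \<in> V i \<and> V i \<subseteq> W i"
      by metis
    have "box J (restrict V J) \<in> \<C>"
      unfolding \<C>_def using fin V by (auto simp: J_def)
    moreover have "x \<in> box J (restrict V J)"
      using V openin_subset[OF U] x by (auto simp: box_def)
    moreover have "box J (restrict V J) \<subseteq> Pi\<^sub>E I W"
    proof
      fix y assume y: "y \<in> box J (restrict V J)"
      have "y i \<in> W i" if "i \<in> I" for i
      proof (cases "i \<in> J")
        case True
        then show ?thesis using y V by (auto simp: box_def)
      next
        case False
        then have "W i = topspace (X i)" using that by (simp add: J_def)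
        then show ?thesis using y that by (auto simp: box_def PiE_iff)
      qed
      then show "y \<in> Pi\<^sub>E I W"
        using y by (auto simp: box_def PiE_iff)
    qed
    ultimately show ?thesis
      using W(3) by (intro bexI[of _ "box J (restrict V J)"] conjI) auto
  qed
  then have "U = \<Union>{V \<in> \<C>. V \<subseteq> U}"
    by (intro equalityI subsetI) (simp_all, metis, blast)
  moreover have "\<Union>{V \<in> \<C>. V \<subseteq> U} \<in> sets (PiM I (\<lambda>i. borel_top (X i)))"
  proof (rule sets.countable_Union)
    show "countable {V \<in> \<C>. V \<subseteq> U}"
      using count by (rule countable_subset[rotated]) auto
    have "box J V \<in> sets (PiM I (\<lambda>i. borel_top (X i)))"
      if "finite J" "J \<subseteq> I" "V \<in> Pi\<^sub>E J B" for J V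
      unfolding box_def using that B(2)
      by (intro open_box_in_sets_PiM_borel) (auto simp: PiE_iff)
    then show "{V \<in> \<C>. V \<subseteq> U} \<subseteq> sets (PiM I (\<lambda>i. borel_top (X i)))"
      by (auto simp: \<C>_def)
  qed
  ultimately show ?thesis by simp
qed

lemma sets_borel_product_subset_PiM:
  assumes "countable I" "\<And>i. i \<in> I \<Longrightarrow> second_countable (X i)"
  shows "sets (borel_top (product_topology X I)) \<subseteq> sets (PiM I (\<lambda>i. borel_top (X i)))"
proof -
  have "sigma_sets (space (PiM I (\<lambda>i. borel_top (X i)))) {U. openin (product_topology X I) U}
      \<subseteq> sets (PiM I (\<lambda>i. borel_top (X i)))"
    using openin_product_in_sets_PiM_borel[where X = X and I = I, OF assms] by (intro sets.sigma_sets_subset) blast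
  moreover have "sets (borel_top (product_topology X I))
      = sigma_sets (space (PiM I (\<lambda>i. borel_top (X i)))) {U. openin (product_topology X I) U}"
  proof -
    have "space (PiM I (\<lambda>i. borel_top (X i))) = topspace (product_topology X I)"
      by (simp add: space_PiM)
    moreover have "{U. openin (product_topology X I) U} \<subseteq> Pow (topspace (product_topology X I))"
      using openin_subset by blast
    ultimately show ?thesis
      unfolding borel_top_def[of "product_topology X I"] by (simp only: sets_measure_of)
  qed
  ultimately show ?thesis by simp
qed

section \<open>Approximation by functions of finitely many coordinates\<close>

definition depends_on :: "'i set \<Rightarrow> ('i \<Rightarrow> 'a) set \<Rightarrow> (('i \<Rightarrow> 'a) \<Rightarrow> 'b) \<Rightarrow> bool" where
  "depends_on J \<Omega> h \<longleftrightarrow> (\<forall>x\<in>\<Omega>. \<forall>y\<in>\<Omega>. (\<forall>i\<in>J. x i = y i) \<longrightarrow> h x = h y)"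

text \<open>
  Membership in the \<open>L\<^sup>1\<close>-closure of the functions of finitely many coordinates.
\<close>

definition cylinder_approximable ::
    "'i set \<Rightarrow> ('i \<Rightarrow> 'a measure) \<Rightarrow> (('i \<Rightarrow> 'a) \<Rightarrow> real) \<Rightarrow> bool" where
  "cylinder_approximable I M f \<longleftrightarrow>
     (\<forall>\<delta>>0. \<exists>J h. finite J \<and> J \<subseteq> I \<and> depends_on J (space (PiM I M)) h \<and>
        integrable (PiM I M) h \<and> (\<integral>x. \<bar>f x - h x\<bar> \<partial>PiM I M) < \<delta>)"

lemma cylinder_approximableI:
  assumes "finite J" "J \<subseteq> I" "depends_on J (space (PiM I M)) f" "integrable (PiM I M) f"
  shows "cylinder_approximable I M f"
  unfolding cylinder_approximable_def using assms by (auto intro!: exI[of _ J] exI[of _ f])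

lemma cylinder_approximableE:
  assumes "cylinder_approximable I M f" "\<delta> > 0"
  obtains J h where "finite J" "J \<subseteq> I" "depends_on J (space (PiM I M)) h"
    "integrable (PiM I M) h" "(\<integral>x. \<bar>f x - h x\<bar> \<partial>PiM I M) < \<delta>"
  using assms unfolding cylinder_approximable_def by blast

lemma cylinder_approximable_cong:
  assumes "cylinder_approximable I M f" "\<And>x. x \<in> space (PiM I M) \<Longrightarrow> f x = g x"
  shows "cylinder_approximable I M g"
proof -
  have "(\<integral>x. \<bar>f x - h x\<bar> \<partial>PiM I M) = (\<integral>x. \<bar>g x - h x\<bar> \<partial>PiM I M)" for h
    by (intro Bochner_Integration.integral_cong) (auto simp: assms(2))
  then show ?thesis
    using assms(1) unfolding cylinder_approximable_def by presburger
qed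

lemma depends_on_add:
  "depends_on J \<Omega> g \<Longrightarrow> depends_on K \<Omega> h \<Longrightarrow> depends_on (J \<union> K) \<Omega> (\<lambda>x. g x + h x)"
  unfolding depends_on_def by (metis UnI1 UnI2)

lemma depends_on_compose: "depends_on J \<Omega> h \<Longrightarrow> depends_on J \<Omega> (\<lambda>x. g (h x))"
  unfolding depends_on_def by metis

lemma cylinder_approximable_add:
  fixes f g :: "('i \<Rightarrow> 'a) \<Rightarrow> real"
  assumes f: "integrable (PiM I M) f" "cylinder_approximable I M f"
    and g: "integrable (PiM I M) g" "cylinder_approximable I M g"
  shows "cylinder_approximable I M (\<lambda>x. f x + g x)"
  unfolding cylinder_approximable_def
proof (intro allI impI)
  fix \<delta> :: real assume "\<delta> > 0"
  then have \<delta>: "\<delta> / 2 > 0" by simp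
  from cylinder_approximableE[OF f(2) \<delta>] obtain J h where h: "finite J" "J \<subseteq> I"
    "depends_on J (space (PiM I M)) h" "integrable (PiM I M) h"
    "(\<integral>x. \<bar>f x - h x\<bar> \<partial>PiM I M) < \<delta> / 2" .
  from cylinder_approximableE[OF g(2) \<delta>] obtain K k where k: "finite K" "K \<subseteq> I"
    "depends_on K (space (PiM I M)) k" "integrable (PiM I M) k"
    "(\<integral>x. \<bar>g x - k x\<bar> \<partial>PiM I M) < \<delta> / 2" .
  have "(\<integral>x. \<bar>f x + g x - (h x + k x)\<bar> \<partial>PiM I M)
      \<le> (\<integral>x. \<bar>f x - h x\<bar> + \<bar>g x - k x\<bar> \<partial>PiM I M)"
    using f g h k by (intro integral_mono) auto
  also have "\<dots> = (\<integral>x. \<bar>f x - h x\<bar> \<partial>PiM I M) + (\<integral>x. \<bar>g x - k x\<bar> \<partial>PiM I M)"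
    using f g h k by (intro Bochner_Integration.integral_add) auto
  finally have "(\<integral>x. \<bar>f x + g x - (h x + k x)\<bar> \<partial>PiM I M) < \<delta>"
    using h k by linarith
  with h k show "\<exists>J h. finite J \<and> J \<subseteq> I \<and> depends_on J (space (PiM I M)) h \<and>
      integrable (PiM I M) h \<and> (\<integral>x. \<bar>f x + g x - h x\<bar> \<partial>PiM I M) < \<delta>"
    by (intro exI[of _ "J \<union> K"] exI[of _ "\<lambda>x. h x + k x"]) (auto intro: depends_on_add)
qed

lemma cylinder_approximable_scale:
  fixes f :: "('i \<Rightarrow> 'a) \<Rightarrow> real"
  assumes f: "cylinder_approximable I M f"
  shows "cylinder_approximable I M (\<lambda>x. c * f x)"
  unfolding cylinder_approximable_def
proof (intro allI impI)
  fix \<delta> :: real assume "\<delta> > 0"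
  \<comment> \<open>The summand 1 keeps the denominator positive when \<open>c = 0\<close>.\<close>
  then have "\<delta> / (\<bar>c\<bar> + 1) > 0" by simp
  from cylinder_approximableE[OF f this] obtain J h where h: "finite J" "J \<subseteq> I"
    "depends_on J (space (PiM I M)) h" "integrable (PiM I M) h"
    "(\<integral>x. \<bar>f x - h x\<bar> \<partial>PiM I M) < \<delta> / (\<bar>c\<bar> + 1)" .
  have "(\<integral>x. \<bar>c * f x - c * h x\<bar> \<partial>PiM I M) = \<bar>c\<bar> * (\<integral>x. \<bar>f x - h x\<bar> \<partial>PiM I M)"
    by (simp add: abs_mult flip: right_diff_distrib)
  also have "\<dots> \<le> (\<bar>c\<bar> + 1) * (\<integral>x. \<bar>f x - h x\<bar> \<partial>PiM I M)"
    by (intro mult_right_mono) auto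
  also have "\<dots> < \<delta>"
    using h(5) by (simp add: pos_less_divide_eq mult.commute)
  finally show "\<exists>J h. finite J \<and> J \<subseteq> I \<and> depends_on J (space (PiM I M)) h \<and>
      integrable (PiM I M) h \<and> (\<integral>x. \<bar>c * f x - h x\<bar> \<partial>PiM I M) < \<delta>"
    using h by (intro exI[of _ J] exI[of _ "\<lambda>x. c * h x"]) (auto intro: depends_on_compose)
qed

lemma cylinder_approximable_L1_limit:
  fixes f :: "('i \<Rightarrow> 'a) \<Rightarrow> real"
  assumes f: "integrable (PiM I M) f"
    and s: "\<And>n. integrable (PiM I M) (s n)" "\<And>n. cylinder_approximable I M (s n)"
    and lim: "(\<lambda>n. \<integral>x. \<bar>f x - s n x\<bar> \<partial>PiM I M) \<longlonglongrightarrow> 0"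
  shows "cylinder_approximable I M f"
  unfolding cylinder_approximable_def
proof (intro allI impI)
  fix \<delta> :: real assume "\<delta> > 0"
  then have \<delta>: "\<delta> / 2 > 0" by simp
  from order_tendstoD(2)[OF lim this]
  obtain n where n: "(\<integral>x. \<bar>f x - s n x\<bar> \<partial>PiM I M) < \<delta> / 2"
    by (auto simp: eventually_sequentially)
  from cylinder_approximableE[OF s(2)[of n] \<delta>] obtain J h where h: "finite J" "J \<subseteq> I"
    "depends_on J (space (PiM I M)) h" "integrable (PiM I M) h"
    "(\<integral>x. \<bar>s n x - h x\<bar> \<partial>PiM I M) < \<delta> / 2" .
  have "(\<integral>x. \<bar>f x - h x\<bar> \<partial>PiM I M)
      \<le> (\<integral>x. \<bar>f x - s n x\<bar> + \<bar>s n x - h x\<bar> \<partial>PiM I M)"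
    using f s h by (intro integral_mono) auto
  also have "\<dots> = (\<integral>x. \<bar>f x - s n x\<bar> \<partial>PiM I M) + (\<integral>x. \<bar>s n x - h x\<bar> \<partial>PiM I M)"
    using f s h by (intro Bochner_Integration.integral_add) auto
  finally have "(\<integral>x. \<bar>f x - h x\<bar> \<partial>PiM I M) < \<delta>"
    using h n by linarith
  with h show "\<exists>J h. finite J \<and> J \<subseteq> I \<and> depends_on J (space (PiM I M)) h \<and>
      integrable (PiM I M) h \<and> (\<integral>x. \<bar>f x - h x\<bar> \<partial>PiM I M) < \<delta>"
    by blast
qed

lemma cylinder_approximable_dominated_limit:
  fixes f :: "('i \<Rightarrow> 'a) \<Rightarrow> real"
  assumes f: "integrable (PiM I M) f"
    and s: "\<And>n. integrable (PiM I M) (s n)" "\<And>n. cylinder_approximable I M (s n)"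
    and lim: "\<And>x. x \<in> space (PiM I M) \<Longrightarrow> (\<lambda>n. s n x) \<longlonglongrightarrow> f x"
    and dom: "\<And>n x. x \<in> space (PiM I M) \<Longrightarrow> \<bar>s n x\<bar> \<le> 2 * \<bar>f x\<bar>"
  shows "cylinder_approximable I M f"
proof (rule cylinder_approximable_L1_limit[OF f s])
  have "(\<lambda>n. \<integral>x. \<bar>f x - s n x\<bar> \<partial>PiM I M) \<longlonglongrightarrow> (\<integral>x. 0 \<partial>PiM I M)"
  proof (rule integral_dominated_convergence[where w = "\<lambda>x. 3 * \<bar>f x\<bar>"])
    show "AE x in PiM I M. (\<lambda>n. \<bar>f x - s n x\<bar>) \<longlonglongrightarrow> 0"
    proof (rule AE_I2)
      fix x assume "x \<in> space (PiM I M)"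
      from tendsto_rabs[OF tendsto_diff[OF tendsto_const[of "f x"] lim[OF this]]]
      show "(\<lambda>n. \<bar>f x - s n x\<bar>) \<longlonglongrightarrow> 0" by simp
    qed
    show "AE x in PiM I M. norm \<bar>f x - s n x\<bar> \<le> 3 * \<bar>f x\<bar>" for n
    proof (rule AE_I2)
      fix x assume "x \<in> space (PiM I M)"
      from dom[OF this, of n] show "norm \<bar>f x - s n x\<bar> \<le> 3 * \<bar>f x\<bar>" by simp
    qed
  qed (use f s in auto)
  then show "(\<lambda>n. \<integral>x. \<bar>f x - s n x\<bar> \<partial>PiM I M) \<longlonglongrightarrow> 0" by simp
qed

text \<open>
  Generating cylinders depend on finitely many coordinates and are closed under intersection, and
  the closure properties above say that the sets with an approximable indicator form a Dynkin
  system; so they comprise the whole product \<open>\<sigma>\<close>-algebra.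
\<close>

lemma cylinder_approximable_indicator:
  assumes M: "\<forall>i\<in>I. prob_space (M i)" and A: "A \<in> sets (PiM I M)"
  shows "cylinder_approximable I M (indicator A)"
proof -
  interpret P: prob_space "PiM I M" using M by (intro prob_space_PiM) auto
  have A': "A \<in> sigma_sets (\<Pi>\<^sub>E i\<in>I. space (M i)) (prod_algebra I M)"
    using A by (simp add: sets_PiM)
  have gen: "B \<in> sets (PiM I M)"
    if "B \<in> sigma_sets (\<Pi>\<^sub>E i\<in>I. space (M i)) (prod_algebra I M)" for B
    using that by (simp add: sets_PiM)
  have ind: "integrable (PiM I M) (indicator B :: _ \<Rightarrow> real)" if "B \<in> sets (PiM I M)" for B
    using that by (intro P.integrable_const_bound[where B = 1]) auto
  have one: "cylinder_approximable I M (\<lambda>_. c)" for c :: real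
    by (rule cylinder_approximableI[of "{}"]) (auto simp: depends_on_def)
  show ?thesis
    using Int_stable_prod_algebra prod_algebra_sets_into_space A'
  proof (induction rule: sigma_sets_induct_disjoint)
    case (basic A)
    then obtain J E where J: "A = prod_emb I M J (\<Pi>\<^sub>E j\<in>J. E j)" "finite J" "J \<subseteq> I"
        "\<And>i. i \<in> J \<Longrightarrow> E i \<in> sets (M i)"
      using prod_algebraE by metis
    then have "A \<in> sets (PiM I M)"
      by (auto intro: sets_PiM_I)
    then have "integrable (PiM I M) (indicator A :: _ \<Rightarrow> real)"
      by (rule ind)
    moreover have "depends_on J (space (PiM I M)) (indicator A :: _ \<Rightarrow> real)"
      unfolding depends_on_def J(1)
      using J(3) by (simp add: mem_prod_emb_PiE indicator_def)
    ultimately show ?case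
      using J by (intro cylinder_approximableI[of J])
  next
    case empty
    show ?case using one[of 0] by simp
  next
    case (compl A)
    have "cylinder_approximable I M (\<lambda>x. 1 + (- 1) * indicator A x)"
      using ind[OF gen[OF compl(1)]] compl(2)
      by (intro cylinder_approximable_add cylinder_approximable_scale one) auto
    then show ?case
      by (rule cylinder_approximable_cong) (auto simp: space_PiM indicator_def)
  next
    case (union A)
    have A: "A n \<in> sets (PiM I M)" for n
      using union(2) by (intro gen) auto
    define s :: "nat \<Rightarrow> ('a \<Rightarrow> 'b) \<Rightarrow> real" where "s n x = (\<Sum>i<n. indicator (A i) x)" for n x
    have int: "integrable (PiM I M) (s n)" for n
      unfolding s_def using A by (intro Bochner_Integration.integrable_sum ind) simp
    have app: "cylinder_approximable I M (s n)" for n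
    proof (induction n)
      case 0
      show ?case using one[of 0] by (simp add: s_def)
    next
      case (Suc n)
      have "cylinder_approximable I M (\<lambda>x. s n x + indicator (A n) x)"
        using A union(3) int Suc by (intro cylinder_approximable_add ind) auto
      then show ?case by (simp add: s_def)
    qed
    show ?case
    proof (rule cylinder_approximable_dominated_limit[OF _ int app])
      show "integrable (PiM I M) (indicator (\<Union>i. A i) :: _ \<Rightarrow> real)"
        using A by (intro ind) auto
      have sums: "(\<lambda>i. indicator (A i) x :: real) sums indicator (\<Union>i. A i) x" for x
        using union(1) by (intro indicator_sums) (auto simp: disjoint_family_on_def)
      then show "(\<lambda>n. s n x) \<longlonglongrightarrow> indicator (\<Union>i. A i) x" for x
        unfolding s_def sums_def .
      have le: "s n x \<le> indicator (\<Union>i. A i) x" for n x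
        using sum_le_suminf[OF sums_summable[OF sums[of x]], of "{..<n}"] sums_unique[OF sums[of x]]
        by (simp add: s_def)
      have nonneg: "0 \<le> s n x" for n x
        unfolding s_def by (intro sum_nonneg) auto
      show "\<bar>s n x\<bar> \<le> 2 * \<bar>indicator (\<Union>i. A i) x\<bar>" for n x
        using le[of n x] nonneg[of n x] by linarith
    qed
  qed
qed

lemma cylinder_approximable_integrable:
  fixes f :: "('i \<Rightarrow> 'a) \<Rightarrow> real"
  assumes M: "\<forall>i\<in>I. prob_space (M i)" and f: "integrable (PiM I M) f"
  shows "cylinder_approximable I M f"
  using f
proof (induction rule: integrable_induct)
  case (base A c)
  show ?case
    using cylinder_approximable_scale[OF cylinder_approximable_indicator[OF M base(1)], of c]
    by (simp add: mult.commute)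
next
  case (add f g)
  then show ?case by (intro cylinder_approximable_add)
next
  case (lim f s)
  then show ?case
    by (intro cylinder_approximable_dominated_limit[of I M f s]) auto
qed

section \<open>Averaging out a set of coordinates\<close>

definition graft :: "'i set \<Rightarrow> 'i set \<Rightarrow> ('i \<Rightarrow> 'a) \<Rightarrow> ('i \<Rightarrow> 'a) \<Rightarrow> 'i \<Rightarrow> 'a" where
  "graft I K y x = (\<lambda>i\<in>I. if i \<in> K then y i else x i)"

lemma graft_apply: "i \<in> I \<Longrightarrow> graft I K y x i = (if i \<in> K then y i else x i)"
  by (simp add: graft_def)

lemma graft_in_space:
  "x \<in> space (PiM I M) \<Longrightarrow> y \<in> space (PiM I M) \<Longrightarrow> graft I K y x \<in> space (PiM I M)"
  by (auto simp: graft_def space_PiM PiE_iff)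

lemma measurable_graft [measurable]:
  "(\<lambda>(x, y). graft I K y x) \<in> PiM I M \<Otimes>\<^sub>M PiM I M \<rightarrow>\<^sub>M PiM I M"
  unfolding graft_def split_beta
proof (rule measurable_restrict)
  fix i assume "i \<in> I"
  then show "(\<lambda>p. if i \<in> K then snd p i else fst p i) \<in> PiM I M \<Otimes>\<^sub>M PiM I M \<rightarrow>\<^sub>M M i"
    by (cases "i \<in> K") auto
qed

lemma measurable_graft_section:
  "x \<in> space (PiM I M) \<Longrightarrow> (\<lambda>y. graft I K y x) \<in> PiM I M \<rightarrow>\<^sub>M PiM I M"
  using measurable_compose[OF measurable_Pair1' measurable_graft] by fastforce

text \<open>
  On a cylinder, the coordinates in \<open>K\<close> constrain only \<open>y\<close> and the others only \<open>x\<close>, so the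
  preimage is a rectangle whose two measures multiply to the measure of the cylinder.
\<close>

lemma distr_graft:
  assumes M: "\<forall>i\<in>I. prob_space (M i)"
  shows "distr (PiM I M \<Otimes>\<^sub>M PiM I M) (PiM I M) (\<lambda>(x, y). graft I K y x) = PiM I M"
proof -
  interpret P: prob_space "PiM I M" using M by (intro prob_space_PiM) auto
  interpret PP: pair_prob_space "PiM I M" "PiM I M" ..
  show ?thesis
  proof (rule measure_eqI_PiM_infinite)
    show "finite_measure (distr (PiM I M \<Otimes>\<^sub>M PiM I M) (PiM I M) (\<lambda>(x, y). graft I K y x))"
      by (intro prob_space.finite_measure PP.prob_space_distr) simp
    fix A J assume J: "finite J" "J \<subseteq> I" "\<And>i. i \<in> J \<Longrightarrow> A i \<in> sets (M i)"
    have "(\<lambda>(x, y). graft I K y x) -` prod_emb I M J (Pi\<^sub>E J A) \<inter> space (PiM I M \<Otimes>\<^sub>M PiM I M)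
        = prod_emb I M (J - K) (Pi\<^sub>E (J - K) A) \<times> prod_emb I M (J \<inter> K) (Pi\<^sub>E (J \<inter> K) A)"
      using J(2)
      by (auto simp: mem_prod_emb_PiE graft_in_space graft_apply subset_iff space_pair_measure
          split: if_splits)
    then have "emeasure (distr (PiM I M \<Otimes>\<^sub>M PiM I M) (PiM I M) (\<lambda>(x, y). graft I K y x))
          (prod_emb I M J (Pi\<^sub>E J A))
        = emeasure (PiM I M \<Otimes>\<^sub>M PiM I M)
            (prod_emb I M (J - K) (Pi\<^sub>E (J - K) A) \<times> prod_emb I M (J \<inter> K) (Pi\<^sub>E (J \<inter> K) A))"
      using J by (subst emeasure_distr) (auto intro: sets_PiM_I)
    also have "\<dots> = (\<Prod>i\<in>J - K. emeasure (M i) (A i)) * (\<Prod>i\<in>J \<inter> K. emeasure (M i) (A i))"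
      using J by (subst P.emeasure_pair_measure_Times)
        (auto intro!: sets_PiM_I arg_cong2[where f = "(*)"] emeasure_PiM_emb simp: M)
    also have "\<dots> = (\<Prod>i\<in>J. emeasure (M i) (A i))"
      using prod.Int_Diff[OF J(1), of "\<lambda>i. emeasure (M i) (A i)" K] by (simp add: mult.commute)
    also have "\<dots> = emeasure (PiM I M) (prod_emb I M J (Pi\<^sub>E J A))"
      using J M by (intro emeasure_PiM_emb[symmetric]) auto
    finally show "emeasure (distr (PiM I M \<Otimes>\<^sub>M PiM I M) (PiM I M) (\<lambda>(x, y). graft I K y x))
          (prod_emb I M J (Pi\<^sub>E J A)) = emeasure (PiM I M) (prod_emb I M J (Pi\<^sub>E J A))" .
  qed auto
qed

text \<open>
  This removes the Dirac factors: the product measure with the coordinates outside \<open>K\<close> frozen is an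
  image of \<open>PiM I M\<close> itself, so its integrals become measurable functions of \<open>x\<close> to which Fubini
  applies.  Both sides are compared on cylinders, where the frozen coordinates contribute a factor 0
  or 1.
\<close>

lemma PiM_Dirac_outside_eq_distr:
  assumes M: "\<forall>i\<in>I. prob_space (M i)" and x: "x \<in> space (PiM I M)"
  shows "PiM I (\<lambda>i. if i \<in> K then M i else return (M i) (x i))
    = distr (PiM I M) (PiM I M) (\<lambda>y. graft I K y x)"
proof -
  let ?N = "\<lambda>i. if i \<in> K then M i else return (M i) (x i)"
  have xi: "x i \<in> space (M i)" if "i \<in> I" for i
    using x that by (auto simp: space_PiM PiE_iff)
  have N: "prob_space (?N i)" if "i \<in> I" for i
    using M that xi by (auto intro: prob_space_return)
  interpret P: prob_space "PiM I M" using M by (intro prob_space_PiM) auto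
  interpret Q: prob_space "PiM I ?N" by (rule prob_space_PiM[OF N])
  have setsN: "sets (PiM I ?N) = sets (PiM I M)"
    by (rule sets_PiM_cong) auto
  show ?thesis
  proof (rule measure_eqI_PiM_infinite[where I = I and M = M])
    show "finite_measure (PiM I ?N)"
      by (rule Q.finite_measure_axioms)
    fix A J assume J: "finite J" "J \<subseteq> I" "\<And>i. i \<in> J \<Longrightarrow> A i \<in> sets (M i)"
    have emb: "prod_emb I M J (Pi\<^sub>E J A) = prod_emb I ?N J (Pi\<^sub>E J A)"
      using sets_eq_imp_space_eq[OF setsN] J(2) by (auto simp: mem_prod_emb_PiE)
    have "emeasure (PiM I ?N) (prod_emb I M J (Pi\<^sub>E J A)) = (\<Prod>i\<in>J. emeasure (?N i) (A i))"
      unfolding emb using J N by (intro emeasure_PiM_emb) auto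
    also have "\<dots> = (\<Prod>i\<in>J \<inter> K. emeasure (?N i) (A i)) * (\<Prod>i\<in>J - K. emeasure (?N i) (A i))"
      using prod.Int_Diff[OF J(1), of _ K] .
    also have "(\<Prod>i\<in>J \<inter> K. emeasure (?N i) (A i)) = (\<Prod>i\<in>J \<inter> K. emeasure (M i) (A i))"
      by (intro prod.cong) auto
    also have "\<dots> = emeasure (PiM I M) (prod_emb I M (J \<inter> K) (Pi\<^sub>E (J \<inter> K) A))"
      using J M by (intro emeasure_PiM_emb[symmetric]) auto
    also have "(\<Prod>i\<in>J - K. emeasure (?N i) (A i)) = (\<Prod>i\<in>J - K. indicator (A i) (x i))"
      using J by (intro prod.cong) (auto simp: emeasure_return)
    also have "\<dots> = (if \<forall>i\<in>J - K. x i \<in> A i then 1 else 0)"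
      using J(1) by (auto simp: indicator_def)
    also have "emeasure (PiM I M) (prod_emb I M (J \<inter> K) (Pi\<^sub>E (J \<inter> K) A)) * \<dots>
        = emeasure (PiM I M)
            ((\<lambda>y. graft I K y x) -` prod_emb I M J (Pi\<^sub>E J A) \<inter> space (PiM I M))"
    proof (cases "\<forall>i\<in>J - K. x i \<in> A i")
      case True
      have "(\<lambda>y. graft I K y x) -` prod_emb I M J (Pi\<^sub>E J A) \<inter> space (PiM I M)
          = prod_emb I M (J \<inter> K) (Pi\<^sub>E (J \<inter> K) A)"
        using True J(2) x
        by (auto simp: mem_prod_emb_PiE graft_in_space graft_apply subset_iff split: if_splits)
      then show ?thesis using True by simp
    next
      case False
      then obtain i where "i \<in> J" "i \<notin> K" "x i \<notin> A i" by auto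
      then have empty: "(\<lambda>y. graft I K y x) -` prod_emb I M J (Pi\<^sub>E J A) \<inter> space (PiM I M) = {}"
        using J(2) by (force simp: mem_prod_emb_PiE graft_apply subset_iff)
      show ?thesis unfolding if_not_P[OF False] empty by simp
    qed
    also have "\<dots> = emeasure (distr (PiM I M) (PiM I M) (\<lambda>y. graft I K y x))
        (prod_emb I M J (Pi\<^sub>E J A))"
      using J by (intro emeasure_distr[symmetric] measurable_graft_section x sets_PiM_I) auto
    finally show "emeasure (PiM I ?N) (prod_emb I M J (Pi\<^sub>E J A))
        = emeasure (distr (PiM I M) (PiM I M) (\<lambda>y. graft I K y x))
            (prod_emb I M J (Pi\<^sub>E J A))" .
  qed (simp_all add: setsN)
qed

text \<open>
  This is the conditional expectation of \<open>f\<close> given the coordinates outside \<open>K\<close>.  Integrating over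
  all coordinates of \<open>y\<close>, and not only those in \<open>K\<close>, keeps every integral on the one space
  \<open>PiM I M\<close>.
\<close>

definition average_out ::
    "'i set \<Rightarrow> ('i \<Rightarrow> 'a measure) \<Rightarrow> 'i set \<Rightarrow> (('i \<Rightarrow> 'a) \<Rightarrow> real) \<Rightarrow> ('i \<Rightarrow> 'a) \<Rightarrow> real" where
  "average_out I M K f x = (\<integral>y. f (graft I K y x) \<partial>PiM I M)"

lemma integral_Dirac_outside_eq_average_out:
  assumes "\<forall>i\<in>I. prob_space (M i)" "x \<in> space (PiM I M)" "f \<in> borel_measurable (PiM I M)"
  shows "(\<integral>y. f y \<partial>PiM I (\<lambda>i. if i \<in> K then M i else return (M i) (x i)))
    = average_out I M K f x"
  unfolding average_out_def using assms
  by (subst PiM_Dirac_outside_eq_distr) (auto intro!: integral_distr measurable_graft_section)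

text \<open>
  By Fubini, \<open>average_out\<close> is a marginal integral of \<open>\<lambda>(x, y). f (graft I K y x)\<close>, and by
  \<open>distr_graft\<close> this function has the same distribution as \<open>f\<close>.  For general integrable \<open>f\<close> the
  inner integrand is integrable only for almost every \<open>x\<close>.
\<close>

lemma
  fixes f :: "('i \<Rightarrow> 'a) \<Rightarrow> real"
  assumes M: "\<forall>i\<in>I. prob_space (M i)" and f: "integrable (PiM I M) f"
  shows integrable_average_out: "integrable (PiM I M) (average_out I M K f)"
    and AE_integrable_graft: "AE x in PiM I M. integrable (PiM I M) (\<lambda>y. f (graft I K y x))"
    and integral_abs_average_out_le:
      "(\<integral>x. \<bar>average_out I M K f x\<bar> \<partial>PiM I M) \<le> (\<integral>x. \<bar>f x\<bar> \<partial>PiM I M)"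
proof -
  let ?P = "PiM I M"
  interpret P: prob_space ?P using M by (intro prob_space_PiM) auto
  interpret PP: pair_prob_space ?P ?P ..
  have fm: "f \<in> borel_measurable ?P" using f by auto
  have spl: "integrable (?P \<Otimes>\<^sub>M ?P) (\<lambda>(x, y). g (graft I K y x))"
    if "integrable ?P g" for g :: "_ \<Rightarrow> real"
  proof -
    have "integrable (distr (?P \<Otimes>\<^sub>M ?P) ?P (\<lambda>(x, y). graft I K y x)) g"
      unfolding distr_graft[OF M] by (rule that)
    then show ?thesis
      using that by (subst (asm) integrable_distr_eq) (auto simp: split_beta')
  qed
  note F = spl[OF f] and aF = spl[OF integrable_abs[OF f]]
  show int: "integrable ?P (average_out I M K f)"
    using PP.integrable_fst'[OF F] by (simp add: average_out_def[abs_def])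
  show "AE x in ?P. integrable ?P (\<lambda>y. f (graft I K y x))"
    using PP.AE_integrable_fst'[OF F] by simp
  have "(\<integral>x. \<bar>average_out I M K f x\<bar> \<partial>?P) \<le> (\<integral>x. average_out I M K (\<lambda>z. \<bar>f z\<bar>) x \<partial>?P)"
    using int PP.integrable_fst'[OF aF]
    by (intro integral_mono) (auto simp: average_out_def[abs_def])
  also have "\<dots> = (\<integral>p. (\<lambda>(x, y). \<bar>f (graft I K y x)\<bar>) p \<partial>(?P \<Otimes>\<^sub>M ?P))"
    using PP.integral_fst'[OF aF] by (simp add: average_out_def)
  also have "\<dots> = (\<integral>z. \<bar>f z\<bar> \<partial>distr (?P \<Otimes>\<^sub>M ?P) ?P (\<lambda>(x, y). graft I K y x))"
    using fm by (subst integral_distr) (auto simp: split_beta')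
  also have "\<dots> = (\<integral>z. \<bar>f z\<bar> \<partial>?P)"
    unfolding distr_graft[OF M] ..
  finally show "(\<integral>x. \<bar>average_out I M K f x\<bar> \<partial>?P) \<le> (\<integral>x. \<bar>f x\<bar> \<partial>?P)" .
qed

lemma average_out_eq_integral:
  assumes h: "depends_on J (space (PiM I M)) h" and J: "J \<subseteq> I" "J \<subseteq> K"
    and x: "x \<in> space (PiM I M)"
  shows "average_out I M K h x = (\<integral>y. h y \<partial>PiM I M)"
  unfolding average_out_def
proof (rule Bochner_Integration.integral_cong[OF refl])
  fix y assume y: "y \<in> space (PiM I M)"
  have "graft I K y x i = y i" if "i \<in> J" for i
    using that J by (simp add: graft_apply subset_iff)
  then show "h (graft I K y x) = h y"
    using h graft_in_space[OF x y, of K] y unfolding depends_on_def by blast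
qed

text \<open>
  For \<open>h\<close> depending only on coordinates in \<open>J\<close> and \<open>J \<subseteq> K\<close>, averaging out \<open>K\<close> turns \<open>h\<close> into its mean.
  For \<open>f\<close> at \<open>L\<^sup>1\<close>-distance less than \<open>\<delta> / 2\<close> from \<open>h\<close>, the error is at most \<open>\<delta> / 2\<close> from averaging
  \<open>f - h\<close>, plus \<open>\<delta> / 2\<close> from the difference of the two means.
\<close>

lemma average_out_L1_convergence:
  fixes f :: "('i \<Rightarrow> 'a) \<Rightarrow> real"
  assumes M: "\<forall>i\<in>I. prob_space (M i)" and f: "integrable (PiM I M) f" and "\<delta> > 0"
  shows "\<exists>J. finite J \<and> J \<subseteq> I \<and> (\<forall>K. J \<subseteq> K \<longrightarrow>
    (\<integral>x. \<bar>average_out I M K f x - (\<integral>y. f y \<partial>PiM I M)\<bar> \<partial>PiM I M) \<le> \<delta>)"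
proof -
  let ?P = "PiM I M"
  interpret P: prob_space ?P using M by (intro prob_space_PiM) auto
  have "\<delta> / 2 > 0" using \<open>\<delta> > 0\<close> by simp
  from cylinder_approximableE[OF cylinder_approximable_integrable[OF M f] this]
  obtain J h where h: "finite J" "J \<subseteq> I" "depends_on J (space ?P) h"
    "integrable ?P h" "(\<integral>x. \<bar>f x - h x\<bar> \<partial>?P) < \<delta> / 2" by blast
  have d: "integrable ?P (\<lambda>x. f x - h x)" using f h by auto
  have "(\<integral>x. \<bar>average_out I M K f x - (\<integral>y. f y \<partial>?P)\<bar> \<partial>?P) \<le> \<delta>" if K: "J \<subseteq> K" for K
  proof -
    have "\<bar>(\<integral>y. h y \<partial>?P) - (\<integral>y. f y \<partial>?P)\<bar> = \<bar>\<integral>y. f y - h y \<partial>?P\<bar>"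
      using f h by (simp add: abs_minus_commute)
    also have "\<dots> \<le> (\<integral>x. \<bar>f x - h x\<bar> \<partial>?P)"
      by (rule integral_abs_bound)
    finally have mean: "\<bar>(\<integral>y. h y \<partial>?P) - (\<integral>y. f y \<partial>?P)\<bar> \<le> \<delta> / 2"
      using h(5) by linarith
    have "AE x in ?P. \<bar>average_out I M K f x - (\<integral>y. f y \<partial>?P)\<bar>
        \<le> \<bar>average_out I M K (\<lambda>z. f z - h z) x\<bar> + \<delta> / 2"
      using AE_integrable_graft[OF M f, of K] AE_integrable_graft[OF M h(4), of K] AE_space
    proof eventually_elim
      case (elim x)
      have "average_out I M K (\<lambda>z. f z - h z) x = average_out I M K f x - average_out I M K h x"
        using elim by (simp add: average_out_def)
      also have "average_out I M K h x = (\<integral>y. h y \<partial>?P)"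
        using elim h K by (intro average_out_eq_integral) auto
      finally show ?case using mean by linarith
    qed
    then have "(\<integral>x. \<bar>average_out I M K f x - (\<integral>y. f y \<partial>?P)\<bar> \<partial>?P)
        \<le> (\<integral>x. \<bar>average_out I M K (\<lambda>z. f z - h z) x\<bar> + \<delta> / 2 \<partial>?P)"
      using integrable_average_out[OF M f, of K] integrable_average_out[OF M d, of K]
      by (intro integral_mono_AE) auto
    also have "\<dots> = (\<integral>x. \<bar>average_out I M K (\<lambda>z. f z - h z) x\<bar> \<partial>?P) + \<delta> / 2"
      using integrable_average_out[OF M d, of K] by (simp add: P.prob_space)
    also have "\<dots> \<le> \<delta>"
      using integral_abs_average_out_le[OF M d, of K] h(5) by linarith
    finally show ?thesis .
  qed
  with h show ?thesis by blast
qed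

section \<open>Strong approximations\<close>

text \<open>
  The exceptional set lies in the set where the deviation at step \<open>n\<close> exceeds \<open>\<epsilon>\<close>, for every
  \<open>n \<ge> 1\<close>.  Markov's inequality bounds the measure of that set by the \<open>L\<^sup>1\<close>-norm of the deviation
  over \<open>\<epsilon>\<close>, which becomes arbitrarily small.
\<close>

lemma AE_average_out_close_to_integral:
  fixes M :: "nat \<Rightarrow> 'a measure"
  assumes M: "\<forall>i\<in>I. prob_space (M i)" and f: "integrable (PiM I M) f" and "\<epsilon> > 0"
  shows "AE x in PiM I M. \<exists>n\<ge>1. \<bar>average_out I M {..<n} f x - (\<integral>y. f y \<partial>PiM I M)\<bar> \<le> \<epsilon>"
proof -
  let ?P = "PiM I M"
  let ?e = "\<lambda>n x. \<bar>average_out I M {..<n} f x - (\<integral>y. f y \<partial>?P)\<bar>"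
  interpret P: prob_space ?P using M by (intro prob_space_PiM) auto
  have e: "integrable ?P (?e n)" for n
    using integrable_average_out[OF M f, of "{..<n}"] by auto
  have [measurable]: "?e n \<in> borel_measurable ?P" for n
    using e[of n] by auto
  define B where "B = {x \<in> space ?P. \<forall>n\<ge>1. \<epsilon> < ?e n x}"
  have B: "B \<in> sets ?P"
    unfolding B_def by measurable
  have "measure ?P B \<le> \<eta>" if "\<eta> > 0" for \<eta>
  proof -
    \<comment> \<open>An \<open>L\<^sup>1\<close>-deviation of at most \<open>\<eta> * \<epsilon>\<close> is requested so that Markov's inequality yields \<open>\<eta>\<close>.\<close>
    have "\<eta> * \<epsilon> > 0" using that \<open>\<epsilon> > 0\<close> by simp
    from average_out_L1_convergence[OF M f this] obtain J where J: "finite J"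
      "\<And>K. J \<subseteq> K \<Longrightarrow> (\<integral>x. \<bar>average_out I M K f x - (\<integral>y. f y \<partial>?P)\<bar> \<partial>?P) \<le> \<eta> * \<epsilon>"
      by metis
    obtain m where "\<forall>j\<in>J. j < m"
      using J(1) finite_nat_set_iff_bounded by auto
    \<comment> \<open>The successor also ensures \<open>n \<ge> 1\<close> when \<open>J\<close> is empty.\<close>
    define n where "n = Suc m"
    have n: "J \<subseteq> {..<n}" "n \<ge> 1"
      using \<open>\<forall>j\<in>J. j < m\<close> by (auto simp: n_def less_Suc_eq)
    have "\<epsilon> * measure ?P B = (\<integral>x. \<epsilon> * indicator B x \<partial>?P)"
      using B by simp
    also have "\<dots> \<le> (\<integral>x. ?e n x \<partial>?P)"
    proof (rule integral_mono[OF _ e])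
      show "integrable ?P (\<lambda>x. \<epsilon> * indicator B x)"
        using B \<open>\<epsilon> > 0\<close> by (intro P.integrable_const_bound[where B = \<epsilon>]) (auto simp: indicator_def)
      show "\<epsilon> * indicator B x \<le> ?e n x" for x
      proof (cases "x \<in> B")
        case True
        then have "\<epsilon> < ?e n x" using n(2) unfolding B_def by blast
        then show ?thesis using True by simp
      qed simp
    qed
    also have "\<dots> \<le> \<eta> * \<epsilon>"
      by (rule J(2)[OF n(1)])
    finally show ?thesis
      using \<open>\<epsilon> > 0\<close> by (simp add: mult.commute)
  qed
  then have "measure ?P B \<le> 0"
    by (rule field_le_epsilon[of _ 0, simplified])
  then have "B \<in> null_sets ?P"
    using B by (simp add: null_setsI P.emeasure_eq_measure measure_le_0_iff)
  then show ?thesis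
    by (rule AE_I') (unfold B_def not_le[symmetric], blast)
qed

theorem theorem6:
  fixes X :: "nat \<Rightarrow> 'a topology"
    and \<sigma> :: "nat \<Rightarrow> 'a measure"
    and f :: "(nat \<Rightarrow> 'a) \<Rightarrow> real"
    and \<epsilon> :: real
  assumes "\<And>i. i \<ge> 1 \<Longrightarrow> polish_topology (X i)"
    and "\<And>i. i \<ge> 1 \<Longrightarrow> borel_prob (X i) (\<sigma> i)"
    and "f \<in> borel_measurable (borel_top (prod_top X))"
    and "bounded (f ` topspace (prod_top X))"
    and "\<epsilon> > 0"
  shows "strong_approx X \<epsilon> \<sigma> f \<in> sets (prod_meas \<sigma>)
    \<and> measure (prod_meas \<sigma>) (strong_approx X \<epsilon> \<sigma> f) = 1"
proof -
  let ?P = "prod_meas \<sigma>"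
  have \<sigma>: "\<forall>i\<in>{1..}. prob_space (\<sigma> i)" "\<And>i. i \<in> {1..} \<Longrightarrow> sets (\<sigma> i) = sets (borel_top (X i))"
    using assms(2) by (auto simp: borel_prob_def)
  interpret P: prob_space ?P
    using \<sigma>(1) by (intro prob_space_PiM) auto
  have sets_P: "sets ?P = sets (PiM {1..} (\<lambda>i. borel_top (X i)))"
    using \<sigma>(2) by (intro sets_PiM_cong) auto
  have space_P: "space ?P = topspace (prod_top X)"
    using sets_eq_imp_space_eq[OF sets_P] by (simp add: space_PiM)
  have "sets (borel_top (prod_top X)) \<subseteq> sets ?P"
    unfolding sets_P using assms(1)
    by (intro sets_borel_product_subset_PiM separable_metrizable_imp_second_countable)
       (auto simp: polish_topology_def intro: completely_metrizable_imp_metrizable_space)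
  then have f: "f \<in> borel_measurable ?P"
    using assms(3) space_P by (auto simp: measurable_def)
  obtain C where "\<And>x. x \<in> space ?P \<Longrightarrow> \<bar>f x\<bar> \<le> C"
    using assms(4) unfolding space_P bounded_iff by auto
  then have int: "integrable ?P f"
    using f by (intro P.integrable_const_bound[of f C]) auto
  let ?S = "{x \<in> space ?P. \<exists>n\<ge>1. \<bar>average_out {1..} \<sigma> {..<n} f x - (\<integral>y. f y \<partial>?P)\<bar> \<le> \<epsilon>}"
  have "(\<integral>y. f y \<partial>prod_meas (tail_dirac \<sigma> n x)) = average_out {1..} \<sigma> {..<n} f x"
    if "x \<in> space ?P" for n x
    using integral_Dirac_outside_eq_average_out[OF \<sigma>(1) that f, of "{..<n}"]
    by (simp add: tail_dirac_def)
  then have S: "strong_approx X \<epsilon> \<sigma> f = ?S"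
    unfolding strong_approx_def space_P[symmetric] by (intro Collect_cong) auto
  have [measurable]: "average_out {1..} \<sigma> {..<n} f \<in> borel_measurable ?P" for n
    using integrable_average_out[OF \<sigma>(1) int, of "{..<n}"] by auto
  have meas: "?S \<in> sets ?P" by measurable
  have "AE x in ?P. x \<in> ?S"
    using AE_average_out_close_to_integral[OF \<sigma>(1) int assms(5)] AE_space by eventually_elim auto
  then have "measure ?P ?S = 1"
    using meas by (subst P.prob_eq_1)
  with meas show ?thesis unfolding S by blast
qed

end
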